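(* If $G$ is a connected split graph different from $K_2$, then $\operatorname{lir}(^2G)\leq 2$.
   Context: All graphs are finite and without loops. A simple graph $G$ is a split graph if its vertex set has a partition $\{X,Y\}$ such that $G[X]$ is a complete graph and $Y$ is an independent set. A multigraph $M$ consists of a nonempty finite vertex set and a multiset of edges (2-element subsets of the vertex set); the degree of a vertex is the sum of the multiplicities of the edges incident to it. For a simple graph $G$, $^2G$ denotes the 2-multigraph obtained from $G$ by replacing each edge of $G$ with two parallel edges. A multigraph is locally irregular if every two adjacent vertices have different degrees. An edge coloring of a multigraph $M$ assigns a color to each element of the edge multiset (it need not be proper, and parallel edges may receive different colors); it is locally irregular if, for each color, the submultigraph of $M$ induced by the edges of that color is locally irregular. The locally irregular chromatic index $\operatorname{lir}(M)$ is the smallest number of colors in a locally irregular edge coloring of $M$, if one exists; so $\operatorname{lir}(M)\leq k$ means that $M$ has a locally irregular edge coloring using at most $k$ colors. *)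

theory Defs
  imports Main "HOL-Library.Multiset" "HOL-Library.Extended_Nat"
begin

section \<open>Simple graphs\<close>

record 'a graph =
  verts :: "'a set"
  edges :: "'a set set"

definition simple_graph :: "'a graph \<Rightarrow> bool" where
  "simple_graph G \<longleftrightarrow> finite (verts G) \<and> verts G \<noteq> {} \<and>
     (\<forall>e\<in>edges G. e \<subseteq> verts G \<and> card e = 2)"

definition connected_graph :: "'a graph \<Rightarrow> bool" where
  "connected_graph G \<longleftrightarrow>
     (\<forall>u\<in>verts G. \<forall>v\<in>verts G. (u, v) \<in> {(x, y). {x, y} \<in> edges G}\<^sup>*)"

text \<open>Either part of the partition may be empty, so complete graphs are split graphs.\<close>

definition split_graph :: "'a graph \<Rightarrow> bool" where
  "split_graph G \<longleftrightarrow> (\<exists>X Y. X \<union> Y = verts G \<and> X \<inter> Y = {} \<and>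
     (\<forall>u\<in>X. \<forall>v\<in>X. u \<noteq> v \<longrightarrow> {u, v} \<in> edges G) \<and>
     (\<forall>u\<in>Y. \<forall>v\<in>Y. {u, v} \<notin> edges G))"

text \<open>\<open>G\<close> is isomorphic to \<open>K\<^sub>2\<close>.\<close>

definition is_K2 :: "'a graph \<Rightarrow> bool" where
  "is_K2 G \<longleftrightarrow> (\<exists>u v. u \<noteq> v \<and> verts G = {u, v} \<and> edges G = {{u, v}})"


section \<open>Multigraphs\<close>

record 'a multigraph =
  mverts :: "'a set"
  medges :: "'a set multiset"

definition wf_multigraph :: "'a multigraph \<Rightarrow> bool" where
  "wf_multigraph M \<longleftrightarrow> finite (mverts M) \<and> mverts M \<noteq> {} \<and>
     (\<forall>e\<in>#medges M. e \<subseteq> mverts M \<and> card e = 2)"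

definition mdegree :: "'a multigraph \<Rightarrow> 'a \<Rightarrow> nat" where
  "mdegree M v = size {#e \<in># medges M. v \<in> e#}"

definition locally_irregular :: "'a multigraph \<Rightarrow> bool" where
  "locally_irregular M \<longleftrightarrow>
     (\<forall>u\<in>mverts M. \<forall>v\<in>mverts M. {u, v} \<in># medges M \<longrightarrow> mdegree M u \<noteq> mdegree M v)"

definition doubled :: "'a graph \<Rightarrow> 'a multigraph" where
  "doubled G = \<lparr>mverts = verts G, medges = repeat_mset 2 (mset_set (edges G))\<rparr>"


section \<open>Locally irregular edge colorings\<close>

text \<open>
  The elements of the edge multiset are made distinguishable: the pair \<open>(e, i)\<close> stands for
  the \<open>i\<close>-th of the parallel copies of \<open>e\<close>. An edge coloring is a function on these pairs; its
  values elsewhere are irrelevant.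
\<close>

definition medge_copies :: "'a multigraph \<Rightarrow> ('a set \<times> nat) set" where
  "medge_copies M = {(e, i). i < count (medges M) e}"

definition color_submultigraph ::
    "'a multigraph \<Rightarrow> ('a set \<times> nat \<Rightarrow> nat) \<Rightarrow> nat \<Rightarrow> 'a multigraph" where
  "color_submultigraph M f c =
     (let N = image_mset fst (mset_set {p \<in> medge_copies M. f p = c})
      in \<lparr>mverts = \<Union> (set_mset N), medges = N\<rparr>)"

definition locally_irregular_coloring ::
    "'a multigraph \<Rightarrow> ('a set \<times> nat \<Rightarrow> nat) \<Rightarrow> bool" where
  "locally_irregular_coloring M f \<longleftrightarrow>
     (\<forall>c\<in>f ` medge_copies M. locally_irregular (color_submultigraph M f c))"

text \<open>The value is \<open>\<infinity>\<close> if there is no locally irregular edge coloring.\<close>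

definition lir :: "'a multigraph \<Rightarrow> enat" where
  "lir M = Inf {enat (card (f ` medge_copies M)) | f. locally_irregular_coloring M f}"


section \<open>Basic facts\<close>

lemma finite_edges: "simple_graph G \<Longrightarrow> finite (edges G)"
  unfolding simple_graph_def by (meson Pow_iff finite_Pow_iff finite_subset subsetI)

lemma count_doubled:
  "simple_graph G \<Longrightarrow> count (medges (doubled G)) e = (if e \<in> edges G then 2 else 0)"
  by (simp add: doubled_def finite_edges count_mset_set')

lemma wf_multigraph_doubled: "simple_graph G \<Longrightarrow> wf_multigraph (doubled G)"
proof -
  assume G: "simple_graph G"
  have "set_mset (medges (doubled G)) = edges G"
    using count_doubled[OF G] by (auto simp: set_mset_def split: if_splits)
  then show ?thesis
    using G by (simp add: wf_multigraph_def simple_graph_def doubled_def)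
qed

lemma finite_medge_copies: "finite (medge_copies M)"
proof -
  have "medge_copies M = (SIGMA e:set_mset (medges M). {..<count (medges M) e})"
    by (auto simp: medge_copies_def intro: count_inI)
  then show ?thesis by simp
qed

lemma count_color_submultigraph:
  "count (medges (color_submultigraph M f c)) e =
     card {i. i < count (medges M) e \<and> f (e, i) = c}"
proof -
  let ?A = "{p \<in> medge_copies M. f p = c}"
  have fin: "finite ?A" using finite_medge_copies[of M] by simp
  have "count (medges (color_submultigraph M f c)) e = card {p \<in> ?A. fst p = e}"
    using fin by (simp add: color_submultigraph_def Let_def count_image_mset
        vimage_def Int_def conj_commute)
  also have "{p \<in> ?A. fst p = e} = Pair e ` {i. i < count (medges M) e \<and> f (e, i) = c}"
    by (auto simp: medge_copies_def)
  also have "card \<dots> = card {i. i < count (medges M) e \<and> f (e, i) = c}"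
    by (rule card_image) (auto simp: inj_on_def)
  finally show ?thesis .
qed

lemma lir_le_iff:
  "lir M \<le> enat k \<longleftrightarrow>
     (\<exists>f. locally_irregular_coloring M f \<and> card (f ` medge_copies M) \<le> k)"
proof
  let ?S = "{enat (card (f ` medge_copies M)) | f. locally_irregular_coloring M f}"
  assume le: "lir M \<le> enat k"
  have "?S \<noteq> {}"
  proof
    assume "?S = {}"
    then have "lir M = \<infinity>" unfolding lir_def by (simp only: Inf_enat_def simp_thms if_True)
    with le show False by simp
  qed
  then have "(LEAST x. x \<in> ?S) \<in> ?S" by (meson LeastI ex_in_conv)
  with \<open>?S \<noteq> {}\<close> have "lir M \<in> ?S"
    unfolding lir_def by (simp only: Inf_enat_def if_False)
  then show "\<exists>f. locally_irregular_coloring M f \<and> card (f ` medge_copies M) \<le> k"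
    using le by auto
next
  assume "\<exists>f. locally_irregular_coloring M f \<and> card (f ` medge_copies M) \<le> k"
  then obtain f where "locally_irregular_coloring M f" "card (f ` medge_copies M) \<le> k" by blast
  then show "lir M \<le> enat k"
    unfolding lir_def by (intro Inf_lower2[of "enat (card (f ` medge_copies M))"]) auto
qed

end

theory Submission
  imports Defs
begin

text \<open>
  Colouring \<open>r e \<le> 2\<close> of the two copies of each edge \<open>e\<close> red and the others blue, one has to
  separate the red degrees along edges with \<open>r e > 0\<close> and the blue ones along edges with
  \<open>r e < 2\<close>. If the clique \<open>X\<close> has \<open>n \<ge> 3\<close> vertices, number them decreasingly in the number of
  neighbours in \<open>Y\<close>, by \<open>1, \<dots>, 2m - 1\<close> if \<open>n\<close> is odd and by \<open>0, \<dots>, 2m - 1\<close> if \<open>n\<close> is even.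
  Give a clique edge between the vertices \<open>i\<close> and \<open>j\<close> the value 2, 1 or 0 according to whether
  \<open>i + j\<close> is less than, equal to or greater than \<open>2m\<close>. The resulting red degrees inside the
  clique strictly decrease, and they are odd except at the middle vertex \<open>m\<close> and at \<open>0\<close>.
  Edges to \<open>Y\<close> are entirely red, except that those at the middle vertex are entirely blue. Then
  red and blue degrees are even on \<open>Y\<close> and at the middle vertex, while they are odd on the other
  clique vertices, up to the vertex \<open>0\<close>, which has no blue edges and the largest red degree of all.

  If the clique is smaller, either a vertex of \<open>Y\<close> enlarges it to a triangle, or \<open>G\<close> is a star or a
  double star; a double star with two centres of equal degree needs mixed colours only on the
  central edge and on one pendant edge.
\<close>

section \<open>Reduction of edge colourings to weights on the simple edges\<close>

definition nbrs :: "'a graph \<Rightarrow> 'a \<Rightarrow> 'a set" where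
  "nbrs G v = {u. {v, u} \<in> edges G}"

text \<open>For a simple graph \<open>G\<close>, this is the degree of \<open>v\<close> in the
  multigraph with \<open>r e\<close> copies of every edge \<open>e\<close> of
  \<open>G\<close>.\<close>

definition wdeg :: "'a graph \<Rightarrow> ('a set \<Rightarrow> nat) \<Rightarrow> 'a \<Rightarrow> nat" where
  "wdeg G r v = (\<Sum>u\<in>nbrs G v. r {v, u})"

lemma edge_verts:
  assumes "simple_graph G" "{u, v} \<in> edges G"
  shows "u \<in> verts G" "v \<in> verts G" "u \<noteq> v"
proof -
  have "{u, v} \<subseteq> verts G \<and> card {u, v} = 2"
    using assms unfolding simple_graph_def by blast
  then show "u \<in> verts G" "v \<in> verts G" "u \<noteq> v" by auto
qed

lemma finite_nbrs: "simple_graph G \<Longrightarrow> finite (nbrs G v)"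
  by (rule finite_subset[of _ "verts G"])
    (auto simp: nbrs_def simple_graph_def)

lemma edges_at_eq_image_nbrs:
  assumes "simple_graph G"
  shows "{e \<in> edges G. v \<in> e} = (\<lambda>u. {v, u}) ` nbrs G v"
proof
  show "{e \<in> edges G. v \<in> e} \<subseteq> (\<lambda>u. {v, u}) ` nbrs G v"
  proof
    fix e assume e: "e \<in> {e \<in> edges G. v \<in> e}"
    then have "card e = 2" using assms by (auto simp: simple_graph_def)
    then obtain a b where "e = {a, b}" by (meson card_2_iff)
    with e show "e \<in> (\<lambda>u. {v, u}) ` nbrs G v"
      by (auto simp: nbrs_def image_iff insert_commute)
  qed
qed (auto simp: nbrs_def)

lemma mdegree_eq_wdeg:
  assumes G: "simple_graph G"
    and count: "\<And>e. count (medges M) e = (if e \<in> edges G then q e else 0)"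
  shows "mdegree M v = wdeg G q v"
proof -
  let ?N = "{#e \<in># medges M. v \<in> e#}" and ?A = "{e \<in> edges G. v \<in> e}"
  have "size ?N = sum (count ?N) (set_mset ?N)"
    by (simp add: size_multiset_overloaded_eq)
  also have "\<dots> = sum (count ?N) ?A"
  proof (rule sum.mono_neutral_left)
    show "set_mset ?N \<subseteq> ?A"
      using count by (auto simp: set_mset_def split: if_splits)
  qed (auto simp: finite_edges[OF G] not_in_iff)
  also have "\<dots> = sum q ?A"
    by (rule sum.cong) (auto simp: count)
  also have "\<dots> = wdeg G q v"
    unfolding edges_at_eq_image_nbrs[OF G] wdeg_def
    by (subst sum.reindex) (auto simp: inj_on_def doubleton_eq_iff)
  finally show ?thesis by (simp add: mdegree_def)
qed

text \<open>Parallel copies are interchangeable, so a 2-colouring is determined, as far as degrees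
  go, by the number \<open>r e\<close> of red copies. The conditions \<open>r {u, v} > 0\<close> and
  \<open>r {u, v} < 2\<close> say that the edge is present in the red and in the blue
  submultigraph.\<close>

lemma lir_doubled_le_2I:
  assumes G: "simple_graph G"
    and r2: "\<And>e. r e \<le> 2"
    and red: "\<And>u v. {u, v} \<in> edges G \<Longrightarrow> r {u, v} > 0 \<Longrightarrow> wdeg G r u \<noteq> wdeg G r v"
    and blue: "\<And>u v. {u, v} \<in> edges G \<Longrightarrow> r {u, v} < 2 \<Longrightarrow>
      wdeg G (\<lambda>e. 2 - r e) u \<noteq> wdeg G (\<lambda>e. 2 - r e) v"
  shows "lir (doubled G) \<le> 2"
proof -
  \<comment> \<open>Colour 0 is red and colour 1 is blue; the first \<open>r e\<close> copies are
    the red ones.\<close>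
  define f :: "'a set \<times> nat \<Rightarrow> nat" where "f = (\<lambda>(e, i). if i < r e then 0 else 1)"
  let ?M = "color_submultigraph (doubled G) f"
  have c0: "count (medges (?M 0)) e = (if e \<in> edges G then r e else 0)" for e
  proof -
    have "{i. i < 2 \<and> f (e, i) = 0} = {..<r e}"
      using r2[of e] by (auto simp: f_def)
    then show ?thesis by (simp add: count_color_submultigraph count_doubled[OF G])
  qed
  have c1: "count (medges (?M 1)) e = (if e \<in> edges G then 2 - r e else 0)" for e
  proof -
    have "{i. i < 2 \<and> f (e, i) = 1} = {r e..<2}"
      using r2[of e] by (auto simp: f_def)
    then show ?thesis by (simp add: count_color_submultigraph count_doubled[OF G])
  qed
  have "locally_irregular (?M 0)"
    unfolding locally_irregular_def mdegree_eq_wdeg[OF G, of "?M 0", OF c0]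
    using red by (auto simp: c0 simp flip: count_greater_zero_iff split: if_splits)
  moreover have "locally_irregular (?M 1)"
    unfolding locally_irregular_def mdegree_eq_wdeg[OF G, of "?M 1", OF c1]
    using blue by (auto simp: c1[unfolded One_nat_def] simp flip: count_greater_zero_iff
        split: if_splits)
  moreover have rng: "f ` medge_copies (doubled G) \<subseteq> {0, 1}"
    by (auto simp: f_def)
  ultimately have "locally_irregular (?M c)" if "c \<in> f ` medge_copies (doubled G)" for c
    using that by (metis empty_iff insert_iff subsetD)
  then have "locally_irregular_coloring (doubled G) f"
    unfolding locally_irregular_coloring_def by (rule ballI)
  moreover have "card (f ` medge_copies (doubled G)) \<le> 2"
    using card_mono[OF _ rng] by simp
  ultimately have "lir (doubled G) \<le> enat 2"
    unfolding lir_le_iff by blast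
  then show ?thesis by (simp add: numeral_eq_enat)
qed

lemma lir_doubled_le_2_of_degrees:
  assumes G: "simple_graph G"
    and deg: "\<And>u v. {u, v} \<in> edges G \<Longrightarrow> card (nbrs G u) \<noteq> card (nbrs G v)"
  shows "lir (doubled G) \<le> 2"
  by (rule lir_doubled_le_2I[OF G, of "\<lambda>_. 2"]) (auto simp: wdeg_def deg)

section \<open>Numbering a clique, and the two degrees inside it\<close>

lemma ex_bij_betw_antimono:
  fixes d :: "'a \<Rightarrow> nat"
  assumes "finite X"
  shows "\<exists>p. bij_betw p X {..<card X} \<and> (\<forall>u\<in>X. \<forall>v\<in>X. p u \<le> p v \<longrightarrow> d v \<le> d u)"
proof -
  obtain xs where xs: "set xs = X" "distinct xs"
    using finite_distinct_list[OF assms] by blast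
  define ys where "ys = rev (sort_key d xs)"
  have ys: "set ys = X" "distinct ys" using xs by (auto simp: ys_def)
  have len: "length ys = card X" using ys distinct_card by fastforce
  have sorted: "sorted (rev (map d ys))" by (simp add: ys_def rev_map)
  have bij: "bij_betw ((!) ys) {..<card X} X"
    by (rule bij_betw_nth[OF ys(2)]) (simp_all add: len ys(1))
  define p where "p = inv_into {..<card X} ((!) ys)"
  have p: "bij_betw p X {..<card X}"
    unfolding p_def by (rule bij_betw_inv_into[OF bij])
  have nth: "ys ! p u = u" if "u \<in> X" for u
    unfolding p_def using bij_betw_inv_into_right[OF bij that] .
  have "d v \<le> d u" if "u \<in> X" "v \<in> X" "p u \<le> p v" for u v
  proof -
    have "p v < length ys" using p that len bij_betwE by fastforce
    then have "map d ys ! p v \<le> map d ys ! p u"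
      using sorted that by (intro sorted_rev_nth_mono) auto
    then show ?thesis using nth that \<open>p v < length ys\<close> by simp
  qed
  with p show ?thesis by blast
qed

text \<open>Red weight of a clique edge whose ends have numbers with sum \<open>s\<close>. The edges
  with \<open>s < t\<close> form a threshold graph; those with \<open>s = t\<close> have one copy of
  each colour.\<close>

definition thr :: "nat \<Rightarrow> nat \<Rightarrow> nat" where
  "thr t s = (if s < t then 2 else if s = t then 1 else 0)"

text \<open>The numbers \<open>{a..<2*m}\<close> with \<open>a\<close> in \<open>{0, 1}\<close>
  cover both parities of the clique size. A full row has the entry 2 for \<open>j < 2*m - i\<close>
  and a single 1 at \<open>j = 2*m - i\<close>, which is in range unless \<open>i = 0\<close>.
  Removing the diagonal entry, which drops from 2 through 1 to 0 around \<open>i = m\<close>,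
  creates the exceptional parity at \<open>m\<close>.\<close>

lemma sum_thr:
  assumes "a \<le> 1" "a \<le> i" "i < 2 * m"
  shows "(\<Sum>j\<in>{a..<2*m} - {i}. thr (2*m) (i + j)) =
    (if i = 0 then 4*m - 2 else if i < m then 4*m - 2*i - 2*a - 1
     else if i = m then 2*m - 2*a else 4*m - 2*i - 2*a + 1)"
proof -
  have all: "(\<Sum>j\<in>{a..<2*m}. thr (2*m) (i + j)) = 2 * (2*m - i - a) + (if i = 0 then 0 else 1)"
  proof -
    have "{a..<2*m} = {a..<2*m-i} \<union> {2*m-i..<2*m}"
      using assms by auto
    then have "(\<Sum>j\<in>{a..<2*m}. thr (2*m) (i + j)) =
        (\<Sum>j\<in>{a..<2*m-i}. thr (2*m) (i + j)) + (\<Sum>j\<in>{2*m-i..<2*m}. thr (2*m) (i + j))"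
      by (simp add: sum.union_disjoint)
    also have "(\<Sum>j\<in>{a..<2*m-i}. thr (2*m) (i + j)) = (\<Sum>j\<in>{a..<2*m-i}. 2)"
      by (rule sum.cong) (auto simp: thr_def)
    also have "(\<Sum>j\<in>{2*m-i..<2*m}. thr (2*m) (i + j)) =
        (\<Sum>j\<in>{2*m-i..<2*m}. if j = 2*m - i then 1 else 0)"
      using assms by (intro sum.cong) (auto simp: thr_def)
    also have "\<dots> = (if i = 0 then 0 else 1)"
      using assms by (subst sum.delta) auto
    finally show ?thesis by simp
  qed
  have "(\<Sum>j\<in>{a..<2*m}. thr (2*m) (i + j)) =
      thr (2*m) (i + i) + (\<Sum>j\<in>{a..<2*m} - {i}. thr (2*m) (i + j))"
    using assms by (intro sum.remove) auto
  then have "(\<Sum>j\<in>{a..<2*m} - {i}. thr (2*m) (i + j)) =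
      2 * (2*m - i - a) + (if i = 0 then 0 else 1) - thr (2*m) (i + i)"
    using all by linarith
  also have "thr (2*m) (i + i) = (if i < m then 2 else if i = m then 1 else 0)"
    by (simp add: thr_def)
  finally show ?thesis using assms by (simp split: if_splits)
qed

text \<open>The two colours together give degree \<open>2 * (2*m - a - 1)\<close> inside the clique.
  After subtraction of the red degree, \<open>a\<close> cancels.\<close>

lemma sum_thr_complement:
  assumes "a \<le> 1" "a \<le> i" "i < 2 * m"
  shows "(\<Sum>j\<in>{a..<2*m} - {i}. 2 - thr (2*m) (i + j)) =
    (if i = 0 then 0 else if i < m then 2*i - 1 else if i = m then 2*m - 2 else 2*i - 3)"
proof -
  let ?S = "\<Sum>j\<in>{a..<2*m} - {i}. 2 - thr (2*m) (i + j)"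
  \<comment> \<open>As \<open>thr\<close> is at most 2, the truncated subtraction is exact.\<close>
  have "?S + (\<Sum>j\<in>{a..<2*m} - {i}. thr (2*m) (i + j))
      = (\<Sum>j\<in>{a..<2*m} - {i}. 2)"
    unfolding sum.distrib[symmetric] by (rule sum.cong) (auto simp: thr_def)
  also have "\<dots> = 2 * (2*m - a - 1)" using assms by simp
  finally have "?S = 2 * (2*m - a - 1) - (\<Sum>j\<in>{a..<2*m} - {i}. thr (2*m) (i + j))"
    by linarith
  then show ?thesis using assms unfolding sum_thr[OF assms] by (simp split: if_splits)
qed

section \<open>Split graphs whose clique has at least three vertices\<close>

lemma lir_doubled_split_ge_3:
  assumes G: "simple_graph G"
    and XY: "X \<union> Y = verts G" "X \<inter> Y = {}"
    and clique: "\<And>u v. u \<in> X \<Longrightarrow> v \<in> X \<Longrightarrow> u \<noteq> v \<Longrightarrow> {u, v} \<in> edges G"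
    and indep: "\<And>u v. u \<in> Y \<Longrightarrow> v \<in> Y \<Longrightarrow> {u, v} \<notin> edges G"
    and n: "card X \<ge> 3"
  shows "lir (doubled G) \<le> 2"
proof -
  have finX: "finite X" using n by (metis card.infinite not_numeral_le_zero)
  \<comment> \<open>The clique size is \<open>2 * m - a\<close>, so \<open>a\<close> is 1 exactly
    for odd size and shifts the numbering to start at 1.\<close>
  define m a where "m = (card X + 1) div 2" and "a = 2 * m - card X"
  have m2: "m \<ge> 2" and a1: "a \<le> 1" and card_X: "card X + a = 2 * m"
    using n by (auto simp: m_def a_def)
  define d where "d v = card (nbrs G v \<inter> Y)" for v
  obtain p0 where p0: "bij_betw p0 X {..<card X}"
      and dp0: "\<forall>u\<in>X. \<forall>v\<in>X. p0 u \<le> p0 v \<longrightarrow> d v \<le> d u"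
    using ex_bij_betw_antimono[OF finX, of d] by blast
  define p where "p v = p0 v + a" for v
  have p: "bij_betw p X {a..<2*m}"
  proof -
    have "(\<lambda>i. i + a) ` {..<card X} = {a..<2*m}"
      using image_add_atLeastLessThan'[of a 0 "card X"] card_X
      by (simp add: atLeast0LessThan add.commute)
    then have "bij_betw (\<lambda>i. i + a) {..<card X} {a..<2*m}"
      by (auto simp: bij_betw_def inj_on_def)
    from bij_betw_trans[OF p0 this] show ?thesis unfolding p_def[abs_def] comp_def .
  qed
  have dp: "d v \<le> d u" if "u \<in> X" "v \<in> X" "p u \<le> p v" for u v
    using dp0 that by (simp add: p_def)
  have p_range: "a \<le> p v" "p v < 2 * m" if "v \<in> X" for v
    using bij_betwE[OF p] that by auto
  have p_inj: "p u \<noteq> p v" if "u \<in> X" "v \<in> X" "u \<noteq> v" for u v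
    using p that by (auto simp: bij_betw_def inj_on_def)
  \<comment> \<open>For a clique edge, \<open>sum p e\<close> adds the numbers of its ends; an edge
    meeting \<open>Y\<close> has just one end in \<open>X\<close>, which the existential
    inspects.\<close>
  define r where "r e = (if e \<inter> Y \<noteq> {} then if \<exists>x\<in>e \<inter> X. p x = m then 0 else 2
      else thr (2 * m) (sum p e))" for e
  have r_XX: "r {u, v} = thr (2*m) (p u + p v)" if "u \<in> X" "v \<in> X" "u \<noteq> v" for u v
    using that XY(2) by (auto simp: r_def)
  have r_XY: "r {u, v} = (if p u = m then 0 else 2)" if "u \<in> X" "v \<in> Y" for u v
    using that XY(2) by (auto simp: r_def)
  have nbrs_X: "nbrs G v = (X - {v}) \<union> (nbrs G v \<inter> Y)" if "v \<in> X" for v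
  proof -
    have "u \<in> X \<union> Y \<and> u \<noteq> v" if "u \<in> nbrs G v" for u
      using edge_verts[OF G, of v u] that XY(1) by (simp add: nbrs_def)
    moreover have "u \<in> nbrs G v" if "u \<in> X - {v}" for u
      using clique[OF \<open>v \<in> X\<close>, of u] that by (auto simp: nbrs_def)
    ultimately show ?thesis by blast
  qed
  have nbrs_Y: "nbrs G v \<subseteq> X" if "v \<in> Y" for v
  proof
    fix u assume "u \<in> nbrs G v"
    then show "u \<in> X"
      using edge_verts(2)[OF G, of v u] XY(1) indep[OF that, of u] by (auto simp: nbrs_def)
  qed
  have wdeg_X: "wdeg G q v = (\<Sum>u\<in>X - {v}. q {v, u}) + (\<Sum>u\<in>nbrs G v \<inter> Y. q {v, u})"
    if "v \<in> X" for q v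
    unfolding wdeg_def using that XY(2) finX finite_nbrs[OF G]
    by (subst nbrs_X[OF that], subst sum.union_disjoint) auto
  have reindex: "(\<Sum>u\<in>X - {v}. h (p v + p u)) = (\<Sum>j\<in>{a..<2*m} - {p v}. h (p v + j))"
    if "v \<in> X" for h :: "nat \<Rightarrow> nat" and v
  proof (rule sum.reindex_bij_betw)
    show "bij_betw p (X - {v}) ({a..<2*m} - {p v})"
      using bij_betw_DiffI[OF p, of "{v}" "{p v}"] p_range[OF that] that
      by (simp add: bij_betw_def)
  qed
  have red_X: "wdeg G r v = (if p v = 0 then 4*m - 2 else if p v < m then 4*m - 2 * p v - 2*a - 1
      else if p v = m then 2*m - 2*a else 4*m - 2 * p v - 2*a + 1) + (if p v = m then 0 else 2 * d v)"
    if "v \<in> X" for v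
  proof -
    have "(\<Sum>u\<in>X - {v}. r {v, u}) = (\<Sum>u\<in>X - {v}. thr (2*m) (p v + p u))"
      using that by (intro sum.cong) (auto simp: r_XX)
    moreover have "(\<Sum>u\<in>nbrs G v \<inter> Y. r {v, u}) = (\<Sum>u\<in>nbrs G v \<inter> Y. if p v = m then 0 else 2)"
      using that by (intro sum.cong) (auto simp: r_XY)
    ultimately show ?thesis
      unfolding wdeg_X[OF that] using sum_thr[OF a1 p_range[OF that]]
      by (simp add: reindex[OF that] d_def)
  qed
  have blue_X: "wdeg G (\<lambda>e. 2 - r e) v = (if p v = 0 then 0 else if p v < m then 2 * p v - 1
      else if p v = m then 2*m - 2 else 2 * p v - 3) + (if p v = m then 2 * d v else 0)"
    if "v \<in> X" for v
  proof -
    have "(\<Sum>u\<in>X - {v}. 2 - r {v, u}) = (\<Sum>u\<in>X - {v}. 2 - thr (2*m) (p v + p u))"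
      using that by (intro sum.cong) (auto simp: r_XX)
    moreover have "(\<Sum>u\<in>nbrs G v \<inter> Y. 2 - r {v, u}) = (\<Sum>u\<in>nbrs G v \<inter> Y. if p v = m then 2 else 0)"
      using that by (intro sum.cong) (auto simp: r_XY)
    ultimately show ?thesis
      unfolding wdeg_X[OF that]
      using sum_thr_complement[OF a1 p_range[OF that]] reindex[OF that, of "\<lambda>s. 2 - thr (2*m) s"]
      by (simp add: d_def)
  qed
  obtain c where c: "c \<in> X" "p c = m"
  proof -
    have "m \<in> p ` X" using bij_betw_imp_surj_on[OF p] m2 a1 by auto
    then show thesis using that by blast
  qed
  have c_unique: "p u = m \<longleftrightarrow> u = c" if "u \<in> X" for u
    using p_inj[OF that c(1)] c(2) by auto
  have red_Y: "wdeg G r y = 2 * card (nbrs G y - {c})" if "y \<in> Y" for y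
  proof -
    have "wdeg G r y = (\<Sum>u\<in>nbrs G y. if u \<in> - {c} then 2 else 0)"
      unfolding wdeg_def using that nbrs_Y[OF that]
      by (intro sum.cong) (auto simp: r_XY c_unique insert_commute[of y] c(2))
    also have "\<dots> = 2 * card (nbrs G y - {c})"
      by (simp add: sum.If_cases finite_nbrs[OF G] Diff_eq del: Compl_iff)
    finally show ?thesis .
  qed
  \<comment> \<open>The only possible blue edge at \<open>y\<close> leads to the middle vertex
    \<open>c\<close>.\<close>
  have blue_Y: "wdeg G (\<lambda>e. 2 - r e) y \<le> 2" if "y \<in> Y" for y
  proof -
    have "wdeg G (\<lambda>e. 2 - r e) y = (\<Sum>u\<in>nbrs G y. if u = c then 2 else 0)"
      unfolding wdeg_def using that nbrs_Y[OF that]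
      by (intro sum.cong) (auto simp: r_XY c_unique insert_commute[of y] c(2))
    also have "\<dots> \<le> 2" by (simp add: sum.delta finite_nbrs[OF G])
    finally show ?thesis .
  qed
  \<comment> \<open>For \<open>a = 0\<close> the bound is exactly the red degree inside the clique
    of the vertex numbered 0, so any neighbour in \<open>Y\<close> lifts that vertex strictly above
    it.\<close>
  have red_Y_le: "wdeg G r y \<le> 4*m - 2*a - 2" if "y \<in> Y" for y
  proof -
    have "card (nbrs G y - {c}) \<le> card (X - {c})"
      using nbrs_Y[OF that] finX by (intro card_mono) auto
    then show ?thesis using c finX card_X red_Y[OF that] by simp
  qed
  have d_pos: "d x > 0" if "{x, y} \<in> edges G" "y \<in> Y" for x y
    unfolding d_def using that finite_nbrs[OF G] by (auto simp: card_gt_0_iff nbrs_def)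
  \<comment> \<open>Edges to \<open>Y\<close> contribute an even amount, so the clique part decides
    the parity.\<close>
  have red_odd: "odd (wdeg G r v)" if "v \<in> X" "p v \<noteq> m" "p v \<noteq> 0" for v
    unfolding red_X[OF that(1)] using that p_range[OF that(1)] m2 a1 by (simp add: odd_pos)
  have blue_odd: "odd (wdeg G (\<lambda>e. 2 - r e) v)" if "v \<in> X" "p v \<noteq> m" "p v \<noteq> 0" for v
    unfolding blue_X[OF that(1)] using that p_range[OF that(1)] m2 by simp
  \<comment> \<open>The clique parts strictly decrease, and by \<open>dp\<close> the contribution of
    \<open>Y\<close> never increases with the number.\<close>
  have red_less: "wdeg G r v < wdeg G r u"
    if "u \<in> X" "v \<in> X" "p u < p v" "p u \<noteq> m" "p v \<noteq> m" for u v
    using dp[of u v] that p_range[OF that(1)] p_range[OF that(2)] m2 a1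
    unfolding red_X[OF that(1)] red_X[OF that(2)] by (simp, intro conjI impI; linarith)
  \<comment> \<open>Away from the middle vertex no edge to \<open>Y\<close> is blue, so the clique
    parts alone are compared.\<close>
  have blue_less: "wdeg G (\<lambda>e. 2 - r e) u < wdeg G (\<lambda>e. 2 - r e) v"
    if "u \<in> X" "v \<in> X" "p u < p v" "p u \<noteq> m" "p v \<noteq> m" for u v
    using that p_range[OF that(1)] p_range[OF that(2)] m2
    unfolding blue_X[OF that(1)] blue_X[OF that(2)] by (simp, intro conjI impI; use m2 that in linarith)
  \<comment> \<open>Having no red edges to \<open>Y\<close>, the middle vertex may leave the
    monotone order. Parity separates it from all but the vertex numbered 0, whose red degree is
    larger.\<close>
  have mid_red: "wdeg G r u \<noteq> wdeg G r v" if "u \<in> X" "v \<in> X" "p u = m" "p v \<noteq> m" for u v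
  proof (cases "p v = 0")
    case True
    then show ?thesis
      unfolding red_X[OF that(1)] red_X[OF that(2)] using that m2 by simp
  next
    case False
    have "even (wdeg G r u)" unfolding red_X[OF that(1)] using that m2 by simp
    with red_odd[OF that(2,4) False] show ?thesis by auto
  qed
  have mid_blue: "wdeg G (\<lambda>e. 2 - r e) u \<noteq> wdeg G (\<lambda>e. 2 - r e) v"
    if "u \<in> X" "v \<in> X" "p u = m" "p v \<noteq> m" for u v
  proof (cases "p v = 0")
    case True
    then show ?thesis
      unfolding blue_X[OF that(1)] blue_X[OF that(2)] using that m2 by simp
  next
    case False
    have "even (wdeg G (\<lambda>e. 2 - r e) u)" unfolding blue_X[OF that(1)] using that m2 by simp
    with blue_odd[OF that(2,4) False] show ?thesis by auto
  qed
  have XX_red: "wdeg G r u \<noteq> wdeg G r v" if "u \<in> X" "v \<in> X" "p u < p v" for u v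
    using red_less[OF that] mid_red[OF that(1,2)] mid_red[OF that(2,1)] that(3) by fastforce
  have XX_blue: "wdeg G (\<lambda>e. 2 - r e) u \<noteq> wdeg G (\<lambda>e. 2 - r e) v"
    if "u \<in> X" "v \<in> X" "p u < p v" for u v
    using blue_less[OF that] mid_blue[OF that(1,2)] mid_blue[OF that(2,1)] that(3) by fastforce
  have XY_red: "wdeg G r x \<noteq> wdeg G r y" if "x \<in> X" "y \<in> Y" "{x, y} \<in> edges G" "p x \<noteq> m" for x y
  proof (cases "p x = 0")
    case True
    then show ?thesis
      using red_X[OF that(1)] red_Y_le[OF that(2)] d_pos[OF that(3,2)] m2 by simp
  next
    case False
    then have "odd (wdeg G r x)" using red_odd that by blast
    then show ?thesis unfolding red_Y[OF that(2)] by auto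
  qed
  \<comment> \<open>With \<open>m\<close> at least 2 and a neighbour in \<open>Y\<close>, the middle
    vertex has blue degree at least 4, against at most 2 on \<open>Y\<close>.\<close>
  have XY_blue: "wdeg G (\<lambda>e. 2 - r e) x \<noteq> wdeg G (\<lambda>e. 2 - r e) y"
    if "x \<in> X" "y \<in> Y" "{x, y} \<in> edges G" "p x = m" for x y
    using blue_X[OF that(1)] blue_Y[OF that(2)] d_pos[OF that(3,2)] that(4) m2 by simp
  have edge_cases: "(u \<in> X \<and> v \<in> X \<and> p u < p v) \<or> (u \<in> X \<and> v \<in> X \<and> p v < p u) \<or>
      (u \<in> X \<and> v \<in> Y) \<or> (u \<in> Y \<and> v \<in> X)" if "{u, v} \<in> edges G" for u v
    using edge_verts[OF G that] XY(1) indep that p_inj by (metis UnE linorder_neqE_nat)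
  show ?thesis
  proof (rule lir_doubled_le_2I[OF G, of r])
    show "r e \<le> 2" for e by (simp add: r_def thr_def)
  next
    fix u v assume e: "{u, v} \<in> edges G" and r: "r {u, v} > 0"
    have e': "{v, u} \<in> edges G" and r': "r {v, u} > 0" using e r by (simp_all add: insert_commute)
    show "wdeg G r u \<noteq> wdeg G r v"
      using edge_cases[OF e] XX_red[of u v] XX_red[of v u] XY_red[of u v] XY_red[of v u]
        r_XY[of u v] r_XY[of v u] e e' r r' by (auto split: if_splits)
  next
    fix u v assume e: "{u, v} \<in> edges G" and r: "r {u, v} < 2"
    have e': "{v, u} \<in> edges G" and r': "r {v, u} < 2" using e r by (simp_all add: insert_commute)
    show "wdeg G (\<lambda>e. 2 - r e) u \<noteq> wdeg G (\<lambda>e. 2 - r e) v"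
      using edge_cases[OF e] XX_blue[of u v] XX_blue[of v u] XY_blue[of u v] XY_blue[of v u]
        r_XY[of u v] r_XY[of v u] e e' r r' by (auto split: if_splits)
  qed
qed

section \<open>Stars and double stars\<close>

lemma connected_graph_nbr:
  assumes "connected_graph G" "u \<in> verts G" "v \<in> verts G" "u \<noteq> v"
  obtains w where "{v, w} \<in> edges G"
proof -
  have "(v, u) \<in> {(x, y). {x, y} \<in> edges G}\<^sup>*"
    using assms unfolding connected_graph_def by blast
  then show thesis using assms(4) that by (cases rule: converse_rtranclE) auto
qed

text \<open>All edges become red. Leaves have one neighbour, so a conflict makes the centre a leaf
  too, and connectedness then leaves only \<open>K2\<close>. Edgeless graphs are included, as
  \<open>center\<close> is then vacuous.\<close>

lemma lir_doubled_star:
  assumes G: "simple_graph G" "connected_graph G" "\<not> is_K2 G"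
    and center: "\<And>e. e \<in> edges G \<Longrightarrow> x \<in> e"
  shows "lir (doubled G) \<le> 2"
proof (rule lir_doubled_le_2_of_degrees[OF G(1)])
  have leaf: "card (nbrs G x) \<noteq> card (nbrs G v)" if e: "{x, v} \<in> edges G" for v
  proof -
    have xv: "x \<in> verts G" "v \<in> verts G" "x \<noteq> v" using edge_verts[OF G(1) e] by auto
    have nv: "nbrs G v = {x}"
      using e center xv(3) by (fastforce simp: nbrs_def insert_commute)
    show ?thesis
    proof
      assume "card (nbrs G x) = card (nbrs G v)"
      then have "card (nbrs G x) = 1" using nv by simp
      moreover have "v \<in> nbrs G x" using e by (simp add: nbrs_def)
      ultimately have nx: "nbrs G x = {v}" by (metis card_1_singletonE singletonD)
      have "edges G = {e \<in> edges G. x \<in> e}" using center by blast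
      also have "\<dots> = {{x, v}}" by (simp add: edges_at_eq_image_nbrs[OF G(1)] nx)
      finally have E: "edges G = {{x, v}}" .
      have "w \<in> {x, v}" if wG: "w \<in> verts G" for w
      proof (rule ccontr)
        assume w: "w \<notin> {x, v}"
        then obtain z where "{w, z} \<in> edges G"
          using connected_graph_nbr[OF G(2) xv(1) wG] by auto
        with E w show False by auto
      qed
      then have "verts G = {x, v}" using xv by auto
      with E xv(3) G(3) show False unfolding is_K2_def by blast
    qed
  qed
  fix u v assume e: "{u, v} \<in> edges G"
  from center[OF e] show "card (nbrs G u) \<noteq> card (nbrs G v)"
    using leaf[of u] leaf[of v] e by (auto simp: insert_commute)
qed

text \<open>If the centres \<open>a\<close> and \<open>b\<close> have different degrees, all edges
  can be red; equal degrees are broken by a small blue path.\<close>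

lemma lir_doubled_double_star:
  assumes G: "simple_graph G"
    and ab: "a \<noteq> b"
    and nbrs_a: "nbrs G a = insert b A" and nbrs_b: "nbrs G b = insert a B"
    and disj: "A \<inter> B = {}" "a \<notin> A \<union> B" "b \<notin> A \<union> B"
    and edges: "\<And>e. e \<in> edges G \<Longrightarrow> a \<in> e \<or> b \<in> e"
    and ne: "A \<noteq> {} \<or> B \<noteq> {}"
  shows "lir (doubled G) \<le> 2"
proof -
  have fin: "finite A" "finite B"
    using finite_nbrs[OF G, of a] finite_nbrs[OF G, of b] nbrs_a nbrs_b by auto
  have adj: "{a, v} \<in> edges G \<longleftrightarrow> v = b \<or> v \<in> A" "{v, a} \<in> edges G \<longleftrightarrow> v = b \<or> v \<in> A"
    "{b, v} \<in> edges G \<longleftrightarrow> v = a \<or> v \<in> B" "{v, b} \<in> edges G \<longleftrightarrow> v = a \<or> v \<in> B" for v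
    using nbrs_a nbrs_b by (auto simp: nbrs_def insert_commute)
  have nbrs_A: "nbrs G v = {a}" if "v \<in> A" for v
    using that disj adj edges by (fastforce simp: nbrs_def)
  have nbrs_B: "nbrs G v = {b}" if "v \<in> B" for v
    using that disj adj edges by (fastforce simp: nbrs_def)
  have edge_cases: "(u = a \<and> v = b) \<or> (u = b \<and> v = a) \<or> (u = a \<and> v \<in> A) \<or> (u \<in> A \<and> v = a) \<or>
      (u = b \<and> v \<in> B) \<or> (u \<in> B \<and> v = b)" if "{u, v} \<in> edges G" for u v
    using edges[OF that] that adj by auto
  show ?thesis
  proof (cases "card A = card B")
    case False
    have pos: "A \<noteq> {} \<Longrightarrow> card A > 0" "B \<noteq> {} \<Longrightarrow> card B > 0"
      using fin by (auto simp: card_gt_0_iff)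
    have cards: "card (nbrs G a) = Suc (card A)" "card (nbrs G b) = Suc (card B)"
      using nbrs_a nbrs_b fin disj by auto
    show ?thesis
    proof (rule lir_doubled_le_2_of_degrees[OF G])
      fix u v assume "{u, v} \<in> edges G"
      from edge_cases[OF this] show "card (nbrs G u) \<noteq> card (nbrs G v)"
        using False pos cards nbrs_A nbrs_B by (elim disjE) auto
    qed
  next
    case True
    then have "B \<noteq> {}" using ne fin by auto
    then obtain y where y: "y \<in> B" by blast
    \<comment> \<open>The blue edges form the path from \<open>a\<close> through \<open>b\<close> to
      \<open>y\<close>, with degrees 1, 2, 1. In red, \<open>a\<close> loses one edge copy and
      \<open>b\<close> loses two, which separates the centres.\<close>
    define r where "r e = (if e = {a, b} \<or> e = {b, y} then 1 else 2 :: nat)" for e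
    have r_simps: "r {a, b} = 1" "r {b, a} = 1" "\<And>v. v \<in> A \<Longrightarrow> r {a, v} = 2"
      "\<And>v. v \<in> A \<Longrightarrow> r {v, a} = 2"
      "\<And>v. v \<in> B \<Longrightarrow> r {b, v} = (if v = y then 1 else 2)"
      "\<And>v. v \<in> B \<Longrightarrow> r {v, b} = (if v = y then 1 else 2)"
      using ab disj y by (auto simp: r_def doubleton_eq_iff)
    obtain k where k: "card B = Suc k" "card (B - {y}) = k"
      using card.remove[OF fin(2) y] by blast
    have sum_a: "wdeg G q a = q {a, b} + (\<Sum>u\<in>A. q {a, u})" for q
      unfolding wdeg_def nbrs_a using fin disj by simp
    have sum_b: "wdeg G q b = q {b, a} + (q {b, y} + (\<Sum>u\<in>B - {y}. q {b, u}))" for q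
      unfolding wdeg_def nbrs_b using fin disj by (simp add: sum.remove[OF _ y])
    have "(\<Sum>u\<in>B - {y}. r {b, u}) = (\<Sum>u\<in>B - {y}. 2)"
      by (rule sum.cong) (auto simp: r_simps)
    then have sum_B: "(\<Sum>u\<in>B - {y}. r {b, u}) = 2 * k" using k by simp
    have sum_B': "(\<Sum>u\<in>B - {y}. 2 - r {b, u}) = 0"
      by (rule sum.neutral) (auto simp: r_simps)
    have red: "wdeg G r a = 2 * Suc k + 1" "wdeg G r b = 2 * Suc k"
      "\<And>v. v \<in> A \<Longrightarrow> wdeg G r v = 2"
      "\<And>v. v \<in> B \<Longrightarrow> wdeg G r v = (if v = y then 1 else 2)"
      unfolding sum_a sum_b using y sum_B
      by (simp_all add: wdeg_def nbrs_A nbrs_B r_simps k True)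
    have blue: "wdeg G (\<lambda>e. 2 - r e) a = 1" "wdeg G (\<lambda>e. 2 - r e) b = 2"
      "\<And>v. v \<in> B \<Longrightarrow> wdeg G (\<lambda>e. 2 - r e) v = (if v = y then 1 else 0)"
      unfolding sum_a sum_b using y sum_B'
      by (simp_all add: wdeg_def nbrs_A nbrs_B r_simps)
    \<comment> \<open>A leaf of \<open>b\<close> other than \<open>y\<close> has red degree 2, so
      \<open>b\<close>, of red degree \<open>2 * Suc k\<close>, needs \<open>k\<close>
      positive.\<close>
    have other: "k \<noteq> 0" if "v \<in> B" "v \<noteq> y" for v
      using that fin(2) k(2) by (auto simp: card_gt_0_iff)
    show ?thesis
    proof (rule lir_doubled_le_2I[OF G, of r])
      show "r e \<le> 2" for e by (simp add: r_def)
    next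
      fix u v assume "{u, v} \<in> edges G"
      from edge_cases[OF this] show "wdeg G r u \<noteq> wdeg G r v"
        using red other[of u] other[of v] by (elim disjE) auto
    next
      fix u v assume "{u, v} \<in> edges G" and "r {u, v} < 2"
      from edge_cases[OF this(1)] this(2)
      show "wdeg G (\<lambda>e. 2 - r e) u \<noteq> wdeg G (\<lambda>e. 2 - r e) v"
        using blue r_simps by (elim disjE) auto
    qed
  qed
qed

section \<open>Case distinction on the size of the clique\<close>

theorem theorem8:
  fixes G :: "'a graph"
  assumes "simple_graph G"
    and "connected_graph G"
    and "split_graph G"
    and "\<not> is_K2 G"
  shows "lir (doubled G) \<le> 2"
proof -
  note G = assms(1)
  obtain X Y where XY: "X \<union> Y = verts G" "X \<inter> Y = {}"
    and X: "\<forall>u\<in>X. \<forall>v\<in>X. u \<noteq> v \<longrightarrow> {u, v} \<in> edges G"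
    and Y: "\<forall>u\<in>Y. \<forall>v\<in>Y. {u, v} \<notin> edges G"
    using assms(3) unfolding split_graph_def by (elim exE conjE)
  have clique: "{u, v} \<in> edges G" if "u \<in> X" "v \<in> X" "u \<noteq> v" for u v
    using X that by blast
  have indep: "{u, v} \<notin> edges G" if "u \<in> Y" "v \<in> Y" for u v
    using Y that by blast
  have finX: "finite X" using G XY(1) unfolding simple_graph_def by (metis finite_Un)
  have edge_X: "e \<inter> X \<noteq> {}" if "e \<in> edges G" for e
  proof -
    have "e \<subseteq> X \<union> Y" "card e = 2" using G that XY(1) by (auto simp: simple_graph_def)
    then obtain u v where "e = {u, v}" "{u, v} \<subseteq> X \<union> Y" by (metis card_2_iff)
    then show ?thesis using indep[of u v] that by auto
  qed
  consider "card X = 0" | "card X = 1" | "card X = 2" | "card X \<ge> 3" by linarith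
  then show ?thesis
  proof cases
    case 1
    then have "edges G = {}" using edge_X finX by auto
    then show ?thesis using lir_doubled_star[OF G assms(2,4)] by simp
  next
    case 2
    then obtain x where "X = {x}" by (rule card_1_singletonE)
    then show ?thesis using lir_doubled_star[OF G assms(2,4), of x] edge_X by auto
  next
    case 3
    then obtain a b where ab: "X = {a, b}" "a \<noteq> b" by (meson card_2_iff)
    define A B where "A = nbrs G a \<inter> Y" and "B = nbrs G b \<inter> Y"
    have eab: "{a, b} \<in> edges G" "{b, a} \<in> edges G" using clique ab by auto
    show ?thesis
    proof (cases "A \<inter> B = {}")
      case False
      then obtain y where y: "y \<in> Y" "{a, y} \<in> edges G" "{b, y} \<in> edges G"
        by (auto simp: A_def B_def nbrs_def)
      have y': "y \<noteq> a" "y \<noteq> b" using y ab XY(2) by auto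
      show ?thesis
      \<comment> \<open>The common neighbour \<open>y\<close> moves from \<open>Y\<close> to the
        clique, which becomes a triangle.\<close>
      proof (rule lir_doubled_split_ge_3[OF G, of "insert y X" "Y - {y}"])
        show "card (insert y X) \<ge> 3" using ab y' by simp
        show "{u, v} \<in> edges G" if "u \<in> insert y X" "v \<in> insert y X" "u \<noteq> v" for u v
          using that ab y eab by (auto simp: insert_commute)
      qed (use XY y indep in auto)
    next
      case True
      have notY: "a \<notin> Y" "b \<notin> Y" using ab XY(2) by auto
      have nbrs: "nbrs G a = insert b A" "nbrs G b = insert a B"
      proof -
        have "u \<in> Y" if "{x, u} \<in> edges G" "x \<in> X" "u \<noteq> a" "u \<noteq> b" for x u
          using edge_verts(2)[OF G that(1)] that XY(1) ab(1) by blast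
        then show "nbrs G a = insert b A" "nbrs G b = insert a B"
          using eab ab edge_verts(3)[OF G, of a a] edge_verts(3)[OF G, of b b]
          unfolding A_def B_def nbrs_def by blast+
      qed
      have edges_ab: "a \<in> e \<or> b \<in> e" if "e \<in> edges G" for e
        using edge_X[OF that] ab by auto
      show ?thesis
      proof (cases "A \<noteq> {} \<or> B \<noteq> {}")
        case ne: True
        show ?thesis
          by (rule lir_doubled_double_star[OF G ab(2) nbrs True _ _ edges_ab ne])
            (use notY in \<open>auto simp: A_def B_def\<close>)
      next
        case False
        \<comment> \<open>As \<open>B\<close> is empty, \<open>a\<close> is the only neighbour of
          \<open>b\<close>, so every edge at \<open>b\<close> contains \<open>a\<close>.\<close>
        then have "a \<in> e" if "e \<in> edges G" for e
          using edges_ab[OF that] nbrs edges_at_eq_image_nbrs[OF G, of b] that by auto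
        then show ?thesis by (rule lir_doubled_star[OF G assms(2,4)])
      qed
    qed
  next
    case 4
    show ?thesis by (rule lir_doubled_split_ge_3[OF G XY clique indep 4])
  qed
qed

end
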